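(* Let $p>2$ be a prime and $G=\mathbb{Z}/p\mathbb{Z}$ (additive group). (1) Suppose $p\equiv 1\pmod 4$. For every group isomorphism $j:G\to\hat G$, the spectrum of $\tilde j\circ\mathcal{F}:\mathbb{C}^G\to\mathbb{C}^G$ is represented by either $\frac{p-1}{4}s+1$ or $\frac{p-1}{4}s+[-1]$. Both cases are possible: each of the two elements represents the spectrum of $\tilde j\circ\mathcal{F}$ for some isomorphism $j:G\to\hat G$. (2) Suppose $p\equiv 3\pmod 4$. For every group isomorphism $j:G\to\hat G$, the spectrum of $\tilde j\circ\mathcal{F}:\mathbb{C}^G\to\mathbb{C}^G$ is represented by either $\frac{p+1}{4}s-[i]$ or $\frac{p+1}{4}s-[-i]$. Both cases are possible: each of the two elements represents the spectrum of $\tilde j\circ\mathcal{F}$ for some isomorphism $j:G\to\hat G$.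
   Context: For a finite abelian group $G$, $\mathbb{C}^G$ is the complex vector space of all functions $G\to\mathbb{C}$, and $\hat G$ is the group of homomorphisms $\chi:G\to S^1=\{z\in\mathbb{C}:|z|=1\}$ under pointwise multiplication. The Fourier transform $\mathcal{F}:\mathbb{C}^G\to\mathbb{C}^{\hat G}$ is $\mathcal{F}(f)(\chi)=\frac{1}{\sqrt{|G|}}\sum_{g\in G}f(g)\chi(g)$. A bijection $j:G\to\hat G$ induces $\tilde j:\mathbb{C}^{\hat G}\to\mathbb{C}^G$, $\tilde j(\phi)(g)=\phi(j(g))$. Let $R_4=\{1,-1,i,-i\}$ be the group of complex $4$th roots of unity and $\mathbb{Z}[R_4]$ its integral group ring, whose elements are written $a=a_1+a_{-1}[-1]+a_i[i]+a_{-i}[-i]$ with integer coefficients, where $[1]=1$ and $[\alpha][\beta]=[\alpha\beta]$. Put $s=1+[-1]+[i]+[-i]\in\mathbb{Z}[R_4]$. An element $a\in\mathbb{Z}[R_4]$ represents the spectrum of a linear operator $A$ (on a finite-dimensional complex vector space) with $A^4=\mathrm{id}$ if, for each $\alpha\in R_4$, $a_\alpha$ is the multiplicity of $\alpha$ as an eigenvalue of $A$ (zero if $\alpha$ is not an eigenvalue). For $G=\mathbb{Z}/p\mathbb{Z}$ and $j$ an isomorphism, $(\tilde j\circ\mathcal{F})^4=\mathrm{id}$. *)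

theory Defs
  imports Complex_Main "HOL-Library.FuncSet" "HOL-Library.Function_Algebras"
    "HOL-Algebra.Elementary_Groups" "HOL-Number_Theory.Cong"
begin

section \<open>The dual group and the Fourier transform\<close>

definition circle_group :: "complex monoid" where
  "circle_group = \<lparr>carrier = {z. cmod z = 1}, monoid.mult = (*), one = 1\<rparr>"

text \<open>Characters are extensional (equal to \<^const>\<open>undefined\<close> off the carrier), so that
  equality of characters is equality on \<open>G\<close>.\<close>

definition dual_group :: "('a, 'm) monoid_scheme \<Rightarrow> ('a \<Rightarrow> complex) monoid" where
  "dual_group G =
     \<lparr>carrier = hom G circle_group \<inter> extensional (carrier G),
      monoid.mult = (\<lambda>\<chi> \<psi>. \<lambda>x\<in>carrier G. \<chi> x * \<psi> x),
      one = (\<lambda>x\<in>carrier G. 1)\<rparr>"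

text \<open>The space of complex functions on a set \<open>S\<close> is realised as the space of functions on the
  ambient type that vanish off \<open>S\<close>; it is then a subspace of a space whose vector
  operations are the pointwise ones.\<close>

definition fun_space :: "'a set \<Rightarrow> ('a \<Rightarrow> complex) set" where
  "fun_space S = {f. \<forall>x. x \<notin> S \<longrightarrow> f x = 0}"

definition fourier :: "('a, 'm) monoid_scheme \<Rightarrow> ('a \<Rightarrow> complex) \<Rightarrow> (('a \<Rightarrow> complex) \<Rightarrow> complex)" where
  "fourier G f = (\<lambda>\<chi>. if \<chi> \<in> carrier (dual_group G)
     then 1 / of_real (sqrt (real (order G))) * (\<Sum>g\<in>carrier G. f g * \<chi> g) else 0)"

definition pullback :: "('a, 'm) monoid_scheme \<Rightarrow> ('a \<Rightarrow> ('a \<Rightarrow> complex)) \<Rightarrow>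
    (('a \<Rightarrow> complex) \<Rightarrow> complex) \<Rightarrow> ('a \<Rightarrow> complex)" where
  "pullback G j \<phi> = (\<lambda>g. if g \<in> carrier G then \<phi> (j g) else 0)"

section \<open>The integral group ring of the fourth roots of unity\<close>

definition R4 :: "complex set" where
  "R4 = {1, -1, \<i>, -\<i>}"

lemma R4_mult: "\<alpha> \<in> R4 \<Longrightarrow> \<beta> \<in> R4 \<Longrightarrow> \<alpha> * \<beta> \<in> R4"
  by (auto simp: R4_def)

lemma sum_R4: "(\<Sum>\<alpha>\<in>R4. f \<alpha>) = f 1 + f (-1) + f \<i> + f (-\<i>)" for f :: "complex \<Rightarrow> int"
  by (simp add: R4_def complex_eq_iff)

lemma R4_div_notin: "\<gamma> \<notin> R4 \<Longrightarrow> \<alpha> \<in> R4 \<Longrightarrow> \<gamma> / \<alpha> \<notin> R4"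
  by (metis R4_def R4_mult divide_eq_0_iff insertE neg_equal_0_iff_equal nonzero_eq_divide_eq
      complex_i_not_zero singletonD zero_neq_one)

typedef zr4 = "{a :: complex \<Rightarrow> int. \<forall>z. z \<notin> R4 \<longrightarrow> a z = 0}"
  morphisms zr4_coeff Abs_zr4
  by (rule exI[of _ "\<lambda>_. 0"]) simp

setup_lifting type_definition_zr4

lift_definition root_elt :: "complex \<Rightarrow> zr4" (\<open>\<lbrakk>_\<rbrakk>\<^sub>R\<close>) is
  "\<lambda>\<alpha> z. if z = \<alpha> \<and> \<alpha> \<in> R4 then 1 else 0"
  by auto

text \<open>The product is convolution over the group: for \<open>\<gamma> \<in> R4\<close>, the pairs
  \<open>(\<alpha>, \<beta>)\<close> with \<open>\<alpha> * \<beta> = \<gamma>\<close> are the pairs \<open>(\<alpha>, \<gamma> / \<alpha>)\<close>.\<close>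

instantiation zr4 :: comm_ring_1
begin

lift_definition zero_zr4 :: zr4 is "\<lambda>_. 0" by simp
lift_definition one_zr4 :: zr4 is "\<lambda>z. if z = 1 then 1 else 0" by (auto simp: R4_def)
lift_definition plus_zr4 :: "zr4 \<Rightarrow> zr4 \<Rightarrow> zr4" is "\<lambda>a b z. a z + b z" by simp
lift_definition minus_zr4 :: "zr4 \<Rightarrow> zr4 \<Rightarrow> zr4" is "\<lambda>a b z. a z - b z" by simp
lift_definition uminus_zr4 :: "zr4 \<Rightarrow> zr4" is "\<lambda>a z. - a z" by simp
lift_definition times_zr4 :: "zr4 \<Rightarrow> zr4 \<Rightarrow> zr4" is "\<lambda>a b \<gamma>. \<Sum>\<alpha>\<in>R4. a \<alpha> * b (\<gamma> / \<alpha>)"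
  by (simp add: R4_div_notin)

instance
proof
  fix a b c :: zr4
  show "a * b * c = a * (b * c)"
    by transfer (simp add: sum_R4 fun_eq_iff algebra_simps)
  show "a * b = b * a"
  proof (transfer, rule ext)
    fix a b :: "complex \<Rightarrow> int" and \<gamma> :: complex
    assume a: "\<forall>z. z \<notin> R4 \<longrightarrow> a z = 0" and b: "\<forall>z. z \<notin> R4 \<longrightarrow> b z = 0"
    show "(\<Sum>\<alpha>\<in>R4. a \<alpha> * b (\<gamma> / \<alpha>)) = (\<Sum>\<alpha>\<in>R4. b \<alpha> * a (\<gamma> / \<alpha>))"
    proof (cases "\<gamma> \<in> R4")
      case True
      then consider "\<gamma> = 1" | "\<gamma> = -1" | "\<gamma> = \<i>" | "\<gamma> = -\<i>" by (auto simp: R4_def)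
      then show ?thesis by cases (simp_all add: sum_R4)
    qed (simp add: R4_div_notin a b)
  qed
  show "1 * a = a"
    by transfer (simp add: sum_R4 fun_eq_iff complex_eq_iff)
qed (transfer; simp add: sum_R4 fun_eq_iff algebra_simps)+

end

lemma root_elt_one: "\<lbrakk>1\<rbrakk>\<^sub>R = 1"
  by transfer (auto simp: R4_def)

lemma root_elt_mult:
  assumes "\<alpha> \<in> R4" "\<beta> \<in> R4"
  shows "\<lbrakk>\<alpha>\<rbrakk>\<^sub>R * \<lbrakk>\<beta>\<rbrakk>\<^sub>R = \<lbrakk>\<alpha> * \<beta>\<rbrakk>\<^sub>R"
  using assms
proof (transfer, intro ext)
  fix \<alpha> \<beta> \<gamma> :: complex
  assume ab: "\<alpha> \<in> R4" "\<beta> \<in> R4"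
  then have "\<alpha> \<noteq> 0" "finite R4" by (auto simp: R4_def)
  have "(\<Sum>x\<in>R4. (if x = \<alpha> \<and> \<alpha> \<in> R4 then 1 else 0) * (if \<gamma> / x = \<beta> \<and> \<beta> \<in> R4 then 1 else 0))
      = (\<Sum>x\<in>R4. if x = \<alpha> then if \<gamma> = \<alpha> * \<beta> then 1 else 0 else (0::int))"
    using ab \<open>\<alpha> \<noteq> 0\<close> by (intro sum.cong) (auto simp: field_simps)
  also have "\<dots> = (if \<gamma> = \<alpha> * \<beta> \<and> \<alpha> * \<beta> \<in> R4 then 1 else 0)"
    using ab \<open>finite R4\<close> R4_mult[OF ab] by simp
  finally show "(\<Sum>x\<in>R4. (if x = \<alpha> \<and> \<alpha> \<in> R4 then 1 else 0) * (if \<gamma> / x = \<beta> \<and> \<beta> \<in> R4 then 1 else 0))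
      = (if \<gamma> = \<alpha> * \<beta> \<and> \<alpha> * \<beta> \<in> R4 then 1 else (0::int))" .
qed

definition s_elt :: zr4 where
  "s_elt = 1 + \<lbrakk>-1\<rbrakk>\<^sub>R + \<lbrakk>\<i>\<rbrakk>\<^sub>R + \<lbrakk>-\<i>\<rbrakk>\<^sub>R"

section \<open>Spectra\<close>

definition cscale :: "complex \<Rightarrow> ('a \<Rightarrow> complex) \<Rightarrow> ('a \<Rightarrow> complex)" where
  "cscale c f = (\<lambda>x. c * f x)"

interpretation cvs: vector_space cscale
  by unfold_locales (simp_all add: cscale_def fun_eq_iff algebra_simps)

text \<open>An operator is a function on the ambient type of which only the restriction to
  the subspace \<open>V\<close> matters.\<close>

definition linear_operator_on :: "('a \<Rightarrow> complex) set \<Rightarrow> (('a \<Rightarrow> complex) \<Rightarrow> ('a \<Rightarrow> complex)) \<Rightarrow> bool" where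
  "linear_operator_on V A \<longleftrightarrow> A \<in> V \<rightarrow> V \<and>
     (\<forall>u\<in>V. \<forall>v\<in>V. A (u + v) = A u + A v) \<and> (\<forall>c. \<forall>v\<in>V. A (cscale c v) = cscale c (A v))"

text \<open>Operators with \<open>A ^^ 4 = id\<close> are diagonalizable, so algebraic and geometric
  multiplicities agree; the multiplicity of \<open>\<alpha>\<close> is the dimension of its eigenspace
  (hence 0 if \<open>\<alpha>\<close> is not an eigenvalue).\<close>

definition eigen_mult ::
    "('a \<Rightarrow> complex) set \<Rightarrow> (('a \<Rightarrow> complex) \<Rightarrow> ('a \<Rightarrow> complex)) \<Rightarrow> complex \<Rightarrow> nat" where
  "eigen_mult V A \<alpha> = cvs.dim {v \<in> V. A v = cscale \<alpha> v}"

definition represents_spectrum ::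
    "zr4 \<Rightarrow> ('a \<Rightarrow> complex) set \<Rightarrow> (('a \<Rightarrow> complex) \<Rightarrow> ('a \<Rightarrow> complex)) \<Rightarrow> bool" where
  "represents_spectrum a V A \<longleftrightarrow>
     cvs.subspace V \<and> (\<exists>B. finite B \<and> cvs.span B = V) \<and>
     linear_operator_on V A \<and> (\<forall>v\<in>V. (A ^^ 4) v = v) \<and>
     (\<forall>\<alpha>\<in>R4. zr4_coeff a \<alpha> = int (eigen_mult V A \<alpha>))"

end

(* An isomorphism j from Z/p to its dual is x |-> (y |-> w^(x y)) for a nontrivial p-th root of
   unity w, so the operator is A f(x) = p^(-1/2) sum_y f(y) w^(x y), and A^2 is the reflection
   x |-> -x. The projection onto the a-eigenspace is the mean of a^(-k) A^k over k < 4, hence the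
   multiplicity of a is its trace (p + a^(-1) g + a^(-2) + a^(-3) cnj g) / 4, where g is the
   quadratic Gauss sum of w divided by sqrt p. One has |g| = 1, and g is real or imaginary
   according to p mod 4. The sign of g is irrelevant: replacing w by w^k for a nonresidue k
   changes it, so both signs occur. *)

theory Submission
  imports Defs "HOL-Number_Theory.Euler_Criterion"
begin

section \<open>Traces of projections\<close>

text \<open>One rule about Gauss sums carries the arithmetic: raising w to a nonresidue exponent
  changes the sign of g. It holds because the squares and k times the squares together cover every
  nonzero residue exactly twice, while the sum of all powers of w vanishes. Conjugation is itself a
  change of root, from w to \<open>w powi (-1)\<close>, so the same rule decides whether g is real
  or imaginary: -1 is a nonresidue when p is 3 mod 4, and a product of two nonresidues when p is 1
  mod 4. Together with |g| = 1 this confines g to two values. Inserted in the trace formula, each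
  value makes three multiplicities equal and singles out one eigenvalue: g itself in the real case,
  the conjugate of g in the imaginary case. No eigenvector is ever exhibited; the multiplicities
  come from traces alone.\<close>

definition delta :: "'a \<Rightarrow> 'a \<Rightarrow> complex" where
  "delta x = (\<lambda>y. if y = x then 1 else 0)"

lemma sum_fun_apply: "(\<Sum>i\<in>I. f i) x = (\<Sum>i\<in>I. f i x)"
  for f :: "'i \<Rightarrow> 'a \<Rightarrow> complex"
  by (induction I rule: infinite_finite_induct) simp_all

lemma subspace_fun_space: "cvs.subspace (fun_space S)"
  by (auto simp: cvs.subspace_def fun_space_def cscale_def)

lemma delta_in_fun_space: "x \<in> S \<Longrightarrow> delta x \<in> fun_space S"
  by (auto simp: delta_def fun_space_def)

lemma fun_space_expand:
  assumes "finite S" "f \<in> fun_space S"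
  shows "f = (\<Sum>x\<in>S. cscale (f x) (delta x))"
proof
  fix y
  have "(\<Sum>x\<in>S. cscale (f x) (delta x)) y = (\<Sum>x\<in>S. if y = x then f x else 0)"
    by (simp add: sum_fun_apply cscale_def delta_def if_distrib cong: if_cong)
  also have "\<dots> = f y"
    using assms by (auto simp: fun_space_def)
  finally show "f y = (\<Sum>x\<in>S. cscale (f x) (delta x)) y" ..
qed

lemma span_delta:
  assumes "finite S"
  shows "cvs.span (delta ` S) = fun_space S"
proof
  show "cvs.span (delta ` S) \<subseteq> fun_space S"
    by (intro cvs.span_minimal subspace_fun_space) (auto intro: delta_in_fun_space)
  show "fun_space S \<subseteq> cvs.span (delta ` S)"
  proof
    fix f assume "f \<in> fun_space S"
    then have "f = (\<Sum>x\<in>S. cscale (f x) (delta x))"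
      using assms by (rule fun_space_expand[rotated])
    also have "\<dots> \<in> cvs.span (delta ` S)"
      by (intro cvs.span_sum cvs.span_scale cvs.span_base) simp
    finally show "f \<in> cvs.span (delta ` S)" .
  qed
qed

text \<open>Additivity of P is known only for arguments in V, so the closure of V under sums and
  scalars has to accompany the induction.\<close>

lemma linear_operator_on_sum:
  assumes "linear_operator_on V P" "cvs.subspace V" "finite I" "\<And>i. i \<in> I \<Longrightarrow> f i \<in> V"
  shows "P (\<Sum>i\<in>I. cscale (c i) (f i)) = (\<Sum>i\<in>I. cscale (c i) (P (f i)))"
  using assms(3,4)
proof (induction I rule: finite_induct)
  case empty
  \<comment> \<open>Homogeneity with the scalar 0 supplies P 0 = 0.\<close>
  have "P (cscale 0 0) = cscale 0 (P 0)"
    using assms(1,2) unfolding linear_operator_on_def cvs.subspace_def by blast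
  then have "P 0 = 0" by simp
  then show ?case by (simp only: sum.empty)
next
  case (insert i I)
  have "cscale (c i) (f i) \<in> V" "(\<Sum>i\<in>I. cscale (c i) (f i)) \<in> V"
    using insert.prems assms(2) by (auto intro!: cvs.subspace_sum cvs.subspace_scale)
  then have "P (cscale (c i) (f i) + (\<Sum>i\<in>I. cscale (c i) (f i)))
      = P (cscale (c i) (f i)) + P (\<Sum>i\<in>I. cscale (c i) (f i))"
    using assms(1) unfolding linear_operator_on_def by blast
  also have "P (cscale (c i) (f i)) = cscale (c i) (P (f i))"
    using assms(1) insert.prems unfolding linear_operator_on_def by blast
  finally show ?case
    using insert by (simp only: sum.insert insert_iff simp_thms)
qed

text \<open>Expanding \<open>P (delta x)\<close> in a basis \<open>B\<close> of \<open>E\<close> and summing over \<open>x\<close> first, the trace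
  becomes the sum over \<open>b \<in> B\<close> of the \<open>b\<close>-coordinate of \<open>P b = b\<close>; this avoids choosing a
  complement of \<open>E\<close>.\<close>

lemma dim_eq_trace_projection:
  assumes S: "finite S" and P: "linear_operator_on (fun_space S) P"
    and E: "cvs.subspace E" "E \<subseteq> fun_space S"
    and into: "\<And>v. v \<in> fun_space S \<Longrightarrow> P v \<in> E" and id: "\<And>v. v \<in> E \<Longrightarrow> P v = v"
  shows "of_nat (cvs.dim E) = (\<Sum>x\<in>S. P (delta x) x)"
proof -
  obtain B where B: "B \<subseteq> E" "cvs.independent B" "E \<subseteq> cvs.span B" "card B = cvs.dim E"
    using cvs.basis_exists by blast
  \<comment> \<open>B is independent and lies in the span of the finitely many functions
    \<open>delta x\<close>.\<close>
  have finB: "finite B"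
    using cvs.independent_span_bound[OF _ B(2), of "delta ` S"] B(1) E(2) S
    by (auto simp: span_delta)
  let ?r = "cvs.representation B"
  have PB: "P (delta x) \<in> cvs.span B" if "x \<in> S" for x
    using into[OF delta_in_fun_space[OF that]] B(3) by blast
  have coord: "(\<Sum>x\<in>S. b x * ?r (P (delta x)) b) = 1" if b: "b \<in> B" for b
  proof -
    have bE: "b \<in> E" "b \<in> fun_space S" using b B(1) E(2) by auto
    have "b = P b" using id bE by simp
    also have "\<dots> = P (\<Sum>x\<in>S. cscale (b x) (delta x))"
      using fun_space_expand[OF S bE(2)] by simp
    also have "\<dots> = (\<Sum>x\<in>S. cscale (b x) (P (delta x)))"
      by (intro linear_operator_on_sum[OF P subspace_fun_space S] delta_in_fun_space)
    finally have "?r b b = ?r (\<Sum>x\<in>S. cscale (b x) (P (delta x))) b" by simp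
    also have "\<dots> = (\<Sum>x\<in>S. b x * ?r (P (delta x)) b)"
      using PB by (simp add: cvs.representation_sum[OF B(2)] cvs.representation_scale[OF B(2)]
          cvs.span_scale)
    finally show ?thesis using cvs.representation_basis[OF B(2) b] by simp
  qed
  have "P (delta x) x = (\<Sum>b\<in>B. b x * ?r (P (delta x)) b)" if "x \<in> S" for x
  proof -
    have "P (delta x) x = (\<Sum>b\<in>B. cscale (?r (P (delta x)) b) b) x"
      using cvs.sum_representation_eq[OF B(2) PB[OF that] finB order_refl] by simp
    then show ?thesis by (simp add: sum_fun_apply cscale_def mult.commute)
  qed
  then have "(\<Sum>x\<in>S. P (delta x) x) = (\<Sum>x\<in>S. \<Sum>b\<in>B. b x * ?r (P (delta x)) b)"
    by simp
  also have "\<dots> = (\<Sum>b\<in>B. \<Sum>x\<in>S. b x * ?r (P (delta x)) b)"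
    by (rule sum.swap)
  finally show ?thesis using coord B(4) by simp
qed

section \<open>Quadratic residues\<close>

text \<open>Squaring is two-to-one on the nonzero residues: primality confines the fibre of y to y
  and p - y, and oddness keeps these apart. A general semiring serves both uses, counting (f = 1
  over the naturals) and exponential sums (f a power of w).\<close>

lemma sum_over_squares:
  fixes f :: "int \<Rightarrow> 'a :: comm_semiring_1"
  assumes p: "prime p" "2 < p"
  defines "S \<equiv> {1..<int p}"
  shows "(\<Sum>x\<in>S. f (x\<^sup>2 mod p)) = 2 * (\<Sum>r\<in>(\<lambda>x. x\<^sup>2 mod p) ` S. f r)"
proof -
  let ?q = "\<lambda>x::int. x\<^sup>2 mod p"
  have pint: "prime (int p)" using p by simp
  have odd: "odd (int p)" using p prime_odd_nat by simp
  have fib: "{x \<in> S. ?q x = ?q y} = {y, int p - y}" "y \<noteq> int p - y" if y: "y \<in> S" for y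
  proof -
    show "y \<noteq> int p - y" using odd by (metis add_diff_cancel_left' diff_add_cancel even_add)
    have "x = y \<or> x = int p - y" if x: "x \<in> S" "?q x = ?q y" for x
    proof -
      have "int p dvd (x - y) * (x + y)"
        using x(2) by (simp add: mod_eq_dvd_iff power2_eq_square algebra_simps)
      then have "int p dvd x - y \<or> int p dvd x + y"
        using pint prime_dvd_mult_iff by blast
      moreover have "x = y" if d: "int p dvd x - y"
      proof (rule ccontr)
        assume "x \<noteq> y"
        then have "int p \<le> \<bar>x - y\<bar>" using d dvd_imp_le_int[of "x - y" "int p"] by simp
        then show False using x y by (auto simp: S_def)
      qed
      \<comment> \<open>Since 0 < x + y < 2 p, the only possible multiple of p is p itself.\<close>
      moreover have "x = int p - y" if d: "int p dvd x + y"
      proof -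
        obtain c where c: "x + y = int p * c" using d by blast
        have "0 < int p * c" "int p * c < int p * 2"
          using x y unfolding c[symmetric] by (auto simp: S_def)
        moreover have "0 < int p" using p by simp
        ultimately have "0 < c" "c < 2"
          using mult_less_cancel_left_pos[of "int p" c 2] by (blast intro: zero_less_mult_pos)+
        then have "c = 1" by simp
        then show ?thesis using c by simp
      qed
      ultimately show ?thesis by blast
    qed
    moreover have "int p - y \<in> S" using y by (auto simp: S_def)
    moreover have "?q (int p - y) = ?q y"
      by (simp add: mod_eq_dvd_iff power2_eq_square algebra_simps)
    ultimately show "{x \<in> S. ?q x = ?q y} = {y, int p - y}" using y by auto
  qed
  have "(\<Sum>x\<in>S. f (?q x)) = (\<Sum>r\<in>?q ` S. \<Sum>x\<in>{x \<in> S. ?q x = r}. f (?q x))"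
    by (rule sum.image_gen) (simp add: S_def)
  also have "\<dots> = (\<Sum>r\<in>?q ` S. 2 * f r)"
  proof (rule sum.cong)
    fix r assume "r \<in> ?q ` S"
    then obtain y where y: "y \<in> S" "r = ?q y" by blast
    have "(\<Sum>x\<in>{x \<in> S. ?q x = r}. f (?q x)) = (\<Sum>x\<in>{x \<in> S. ?q x = r}. f r)"
      by (rule sum.cong) auto
    also have "\<dots> = of_nat (card {y, int p - y}) * f r"
      using fib(1)[OF y(1)] by (simp only: y(2) sum_constant)
    also have "card {y, int p - y} = 2"
      using fib(2)[OF y(1)] card_2_iff by blast
    finally show "(\<Sum>x\<in>{x \<in> S. ?q x = r}. f (?q x)) = 2 * f r" by simp
  qed simp
  finally show ?thesis by (simp add: sum_distrib_left)
qed

lemma card_squares: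
  assumes "prime p" "2 < p"
  shows "2 * card ((\<lambda>x. x\<^sup>2 mod int p) ` {1..<int p}) = p - 1"
  using sum_over_squares[OF assms, of "\<lambda>_. 1 :: nat"] by simp

lemma square_mod_nonzero:
  assumes "prime p" "x \<in> {1..<int p}"
  shows "x\<^sup>2 mod int p \<in> {1..<int p}"
proof -
  have "\<not> int p dvd x\<^sup>2"
    using assms zdvd_not_zless[of x "int p"] by (simp add: prime_dvd_power_iff)
  then have "x\<^sup>2 mod int p \<noteq> 0" by (simp add: dvd_eq_mod_eq_0)
  moreover have "0 \<le> x\<^sup>2 mod int p" "x\<^sup>2 mod int p < int p"
    using assms by simp_all
  ultimately show ?thesis by simp
qed

text \<open>Squares fill only half of the nonzero residues. A witness for \<open>QuadRes\<close> may
  be any integer, so it is reduced mod p before it meets this count.\<close>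

lemma exists_quadratic_nonresidue:
  assumes "prime p" "2 < p"
  obtains k where "\<not> QuadRes (int p) k"
proof -
  let ?R = "(\<lambda>x. x\<^sup>2 mod int p) ` {1..<int p}"
  have "card ?R < card {1..<int p}" using card_squares[OF assms] assms(2) by simp
  then have "\<not> {1..<int p} \<subseteq> ?R" using card_mono[of ?R "{1..<int p}"] by auto
  then obtain k where k: "k \<in> {1..<int p}" "k \<notin> ?R" by blast
  have "\<not> QuadRes (int p) k"
  proof
    assume "QuadRes (int p) k"
    then obtain y where y: "[y\<^sup>2 = k] (mod int p)" by (auto simp: QuadRes_def)
    then have eq: "(y mod int p)\<^sup>2 mod int p = k"
      using k(1) by (simp add: cong_def power_mod)
    have "y mod int p \<noteq> 0" using eq k(1) by auto
    moreover have "0 \<le> y mod int p" "y mod int p < int p" using assms by simp_all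
    ultimately have "y mod int p \<in> {1..<int p}" by simp
    then show False using eq k(2) by blast
  qed
  then show ?thesis using that by blast
qed

text \<open>Euler's criterion gives the Legendre symbol only modulo p; because p > 2 separates 1
  from -1, the congruence fixes its value. The exponent (p - 1) / 2 is even exactly when p is 1 mod
  4.\<close>

lemma QuadRes_minus_one:
  assumes "prime p" "2 < p"
  shows "QuadRes (int p) (-1) \<longleftrightarrow> [p = 1] (mod 4)"
proof -
  have odd: "odd p" using assms prime_odd_nat by simp
  have nd: "\<not> [-1 = 0] (mod int p)" using assms by (simp add: cong_iff_dvd_diff)
  have neq: "\<not> [-1 = 1] (mod int p)" "\<not> [1 = -1] (mod int p)"
    using assms zdvd_imp_le[of "int p" 2] by (auto simp: cong_iff_dvd_diff)
  have L: "[Legendre (-1) p = (-1) ^ ((p - 1) div 2)] (mod int p)"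
    by (rule euler_criterion[OF assms])
  show ?thesis
  proof (cases "p mod 4 = 1")
    case True
    then have "even ((p - 1) div 2)" by presburger
    then have "[Legendre (-1) p = 1] (mod int p)" using L by simp
    then show ?thesis using True nd neq by (auto simp: Legendre_def cong_def split: if_splits)
  next
    case False
    then have "odd ((p - 1) div 2)" using odd by presburger
    then have "[Legendre (-1) p = -1] (mod int p)" using L by simp
    then show ?thesis using False nd neq by (auto simp: Legendre_def cong_def split: if_splits)
  qed
qed

lemma nonresidue_not_dvd:
  assumes "\<not> QuadRes m k"
  shows "\<not> m dvd k"
proof
  assume "m dvd k"
  then have "[0\<^sup>2 = k] (mod m)" by (simp add: cong_def dvd_eq_mod_eq_0)
  then show False using assms unfolding QuadRes_def by blast
qed

text \<open>Multiplication by k moves the set R of nonzero squares to a disjoint set of the same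
  size (p - 1) / 2, so the two sets exhaust the nonzero residues, and each element is attained by
  two values of x.\<close>

lemma sum_squares_nonresidue:
  fixes f :: "int \<Rightarrow> 'a :: comm_semiring_1"
  assumes p: "prime p" "2 < p" and k: "\<not> QuadRes (int p) k"
  shows "(\<Sum>x\<in>{1..<int p}. f (x\<^sup>2 mod p)) + (\<Sum>x\<in>{1..<int p}. f (k * x\<^sup>2 mod p))
    = 2 * (\<Sum>x\<in>{1..<int p}. f x)"
proof -
  let ?S = "{1..<int p}" and ?m = "\<lambda>r. k * r mod int p"
  define R where "R = (\<lambda>x. x\<^sup>2 mod int p) ` ?S"
  have pint: "prime (int p)" using p by simp
  have "\<not> int p dvd k" using k by (rule nonresidue_not_dvd)
  then have cop: "coprime k (int p)"
    using prime_imp_coprime[OF pint, of k] by (simp add: coprime_commute)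
  have RS: "R \<subseteq> ?S" unfolding R_def using square_mod_nonzero[OF p(1)] by blast
  have inj: "inj_on ?m R"
  proof (rule inj_onI)
    fix r t assume "r \<in> R" "t \<in> R" "?m r = ?m t"
    then have "[k * r = k * t] (mod int p)" by (simp add: cong_def)
    then have "[r = t] (mod int p)" using cop by (simp add: cong_mult_lcancel)
    moreover have "r \<in> ?S" "t \<in> ?S" using \<open>r \<in> R\<close> \<open>t \<in> R\<close> RS by blast+
    ultimately show "r = t" using cong_less_imp_eq_int[of r "int p" t] by simp
  qed
  have TS: "?m ` R \<subseteq> ?S"
  proof
    fix t assume "t \<in> ?m ` R"
    then obtain r where r: "r \<in> R" "t = ?m r" by blast
    have "\<not> int p dvd r" using r(1) RS zdvd_not_zless[of r "int p"] by auto
    then have "\<not> int p dvd k * r"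
      using \<open>\<not> int p dvd k\<close> prime_dvd_mult_iff[OF pint] by blast
    then have "t \<noteq> 0" unfolding r(2) by (simp only: dvd_eq_mod_eq_0 not_False_eq_True)
    moreover have "0 \<le> t" "t < int p" using r p by simp_all
    ultimately show "t \<in> ?S" by simp
  qed
  \<comment> \<open>From y^2 = k x^2 modulo p, division by x would make k the square of y / x; z
    below is the inverse of x.\<close>
  have disj: "R \<inter> ?m ` R = {}"
  proof (rule ccontr)
    assume "R \<inter> ?m ` R \<noteq> {}"
    then obtain x y where x: "x \<in> ?S" and y: "y \<in> ?S"
      and eq: "y\<^sup>2 mod int p = k * (x\<^sup>2 mod int p) mod int p"
      unfolding R_def by blast
    have "\<not> int p dvd x" using x zdvd_not_zless[of x "int p"] by auto
    then have "coprime x (int p)"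
      using prime_imp_coprime[OF pint, of x] by (simp add: coprime_commute)
    then obtain z where z: "[x * z = 1] (mod int p)" using cong_solve_coprime_int by blast
    have "[y\<^sup>2 = k * x\<^sup>2] (mod int p)" using eq by (simp add: cong_def mod_mult_right_eq)
    then have "[y\<^sup>2 * z\<^sup>2 = k * x\<^sup>2 * z\<^sup>2] (mod int p)" by (rule cong_scalar_right)
    also have "k * x\<^sup>2 * z\<^sup>2 = k * (x * z)\<^sup>2" by (simp add: power_mult_distrib)
    also have "[k * (x * z)\<^sup>2 = k * 1\<^sup>2] (mod int p)"
      by (intro cong_scalar_left cong_pow z)
    finally have "[(y * z)\<^sup>2 = k] (mod int p)" by (simp add: power_mult_distrib)
    then show False using k by (auto simp: QuadRes_def)
  qed
  have fin: "finite R" by (simp add: R_def)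
  have "card (R \<union> ?m ` R) = card ?S"
    using card_squares[OF p] card_Un_disjoint[OF fin _ disj] fin card_image[OF inj]
    by (simp add: R_def)
  then have un: "R \<union> ?m ` R = ?S"
    using RS TS by (intro card_subset_eq) auto
  have "(\<Sum>x\<in>?S. f (k * x\<^sup>2 mod p)) = (\<Sum>x\<in>?S. (f \<circ> ?m) (x\<^sup>2 mod p))"
    by (simp add: mod_mult_right_eq)
  also have "\<dots> = 2 * (\<Sum>r\<in>R. (f \<circ> ?m) r)"
    unfolding R_def by (rule sum_over_squares[OF p])
  also have "(\<Sum>r\<in>R. (f \<circ> ?m) r) = (\<Sum>t\<in>?m ` R. f t)"
    using inj by (simp add: sum.reindex)
  finally have "(\<Sum>x\<in>?S. f (x\<^sup>2 mod p)) + (\<Sum>x\<in>?S. f (k * x\<^sup>2 mod p))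
      = 2 * ((\<Sum>r\<in>R. f r) + (\<Sum>t\<in>?m ` R. f t))"
    using sum_over_squares[OF p, of f] by (simp add: R_def distrib_left)
  also have "(\<Sum>r\<in>R. f r) + (\<Sum>t\<in>?m ` R. f t) = (\<Sum>x\<in>?S. f x)"
    using fin disj un by (simp add: sum.union_disjoint[symmetric])
  finally show ?thesis .
qed

section \<open>Gauss sums\<close>

text \<open>The root is an explicit argument because the key identities compare the sums at w and at
  a power of w. Integer exponents let conjugation be a negation of the exponent.\<close>

definition gauss_sum :: "nat \<Rightarrow> complex \<Rightarrow> complex" where
  "gauss_sum p w = (\<Sum>x\<in>{0..<int p}. w powi (x\<^sup>2))"

lemma sum_mod_shift:
  fixes f :: "int \<Rightarrow> 'a :: comm_monoid_add"
  assumes "0 < m"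
  shows "(\<Sum>x\<in>{0..<m}. f ((x + b) mod m)) = (\<Sum>x\<in>{0..<m}. f x)"
  by (rule sum.reindex_bij_witness[of _ "\<lambda>x. (x - b) mod m" "\<lambda>x. (x + b) mod m"])
    (use assms in \<open>auto simp: mod_simps\<close>)

locale root_of_unity =
  fixes p :: nat and w :: complex
  assumes p: "prime p" and root: "w ^ p = 1" and nontrivial: "w \<noteq> 1"
begin

lemma p_pos: "0 < int p"
  using p prime_gt_0_nat by simp

lemma nonzero: "w \<noteq> 0"
  using root p_pos by (auto simp: power_0_left)

lemma powi_p: "w powi int p = 1"
  using root by simp

lemma powi_mod: "w powi (n mod int p) = w powi n"
proof -
  have "w powi n = w powi (int p * (n div int p) + n mod int p)" by simp
  also have "\<dots> = (w powi int p) powi (n div int p) * w powi (n mod int p)"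
    by (subst power_int_add) (use nonzero in \<open>simp_all only: power_int_mult, simp_all\<close>)
  finally show ?thesis unfolding powi_p by simp
qed

lemma powi_cong: "[m = n] (mod int p) \<Longrightarrow> w powi m = w powi n"
  by (metis powi_mod cong_def)

lemma powi_eq_1_iff: "w powi n = 1 \<longleftrightarrow> int p dvd n"
proof
  assume "int p dvd n"
  then have "[n = 0] (mod int p)" by (simp add: cong_def dvd_eq_mod_eq_0)
  then show "w powi n = 1" using powi_cong by fastforce
next
  assume 1: "w powi n = 1"
  show "int p dvd n"
  proof (rule ccontr)
    assume "\<not> int p dvd n"
    then have "coprime n (int p)"
      using p prime_imp_coprime[of "int p" n] coprime_commute by auto
    \<comment> \<open>With z inverse to n modulo p, w = (w^n)^z = 1, contrary to
      nontriviality.\<close>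
    then obtain z where "[n * z = 1] (mod int p)" using cong_solve_coprime_int by blast
    then have "w powi (n * z) = w" using powi_cong by fastforce
    then show False using 1 nontrivial by (simp add: power_int_mult)
  qed
qed

text \<open>Allows the locale to be interpreted again at \<open>w powi k\<close>, as needed for the
  conjugate root and for the twist by a nonresidue.\<close>

lemma root_of_unity_powi: "\<not> int p dvd k \<Longrightarrow> root_of_unity p (w powi k)"
  using p powi_eq_1_iff powi_eq_1_iff[of "k * int p"]
  by unfold_locales (simp_all add: power_int_mult)

text \<open>Orthogonality of characters: the shift of x by 1 permutes the residues and multiplies
  the sum by \<open>w powi a\<close>, so the sum vanishes unless this factor is 1.\<close>

lemma sum_powi: "(\<Sum>x\<in>{0..<int p}. w powi (a * x)) = (if int p dvd a then of_nat p else 0)"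
proof (cases "int p dvd a")
  case True
  then have "w powi (a * x) = 1" for x by (simp add: powi_eq_1_iff)
  then show ?thesis using True by simp
next
  case False
  let ?s = "\<Sum>x\<in>{0..<int p}. w powi (a * x)"
  have "?s = (\<Sum>x\<in>{0..<int p}. w powi (a * ((x + 1) mod int p)))"
    by (rule sum_mod_shift[OF p_pos, symmetric])
  also have "\<dots> = (\<Sum>x\<in>{0..<int p}. w powi a * w powi (a * x))"
  proof (rule sum.cong)
    fix x
    have "w powi (a * ((x + 1) mod int p)) = w powi (a + a * x)"
      by (rule powi_cong) (simp add: cong_def mod_mult_right_eq algebra_simps)
    then show "w powi (a * ((x + 1) mod int p)) = w powi a * w powi (a * x)"
      using nonzero by (simp add: power_int_add)
  qed simp
  also have "\<dots> = w powi a * ?s" by (rule sum_distrib_left[symmetric])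
  finally show ?thesis using False powi_eq_1_iff[of a] by auto
qed

lemma cmod_root: "cmod w = 1"
proof -
  have "cmod w ^ p = 1" using root by (metis norm_one norm_power)
  then show ?thesis using p_pos power_eq_1_iff[of "cmod w" p] by simp
qed

lemma cnj_powi: "cnj (w powi n) = w powi (- n)"
proof -
  have "cnj w = inverse w"
    using cmod_root complex_div_cnj[of 1 w] by (simp add: inverse_eq_divide)
  then show ?thesis by (simp add: complex_cnj_power_int power_int_inverse power_int_minus)
qed

lemma cnj_gauss_sum: "cnj (gauss_sum p w) = gauss_sum p (w powi (-1))"
  unfolding gauss_sum_def by (simp only: cnj_sum cnj_powi power_int_mult[symmetric]) simp

text \<open>The substitution x = t + y turns x^2 - y^2 into t^2 + 2 t y, linear in y. Orthogonality
  in y then keeps only t = 0, as 2 is invertible modulo the odd p.\<close>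

lemma gauss_sum_mult_cnj:
  assumes "odd p"
  shows "gauss_sum p w * cnj (gauss_sum p w) = of_nat p"
proof -
  let ?S = "{0..<int p}"
  have "gauss_sum p w * cnj (gauss_sum p w)
      = (\<Sum>y\<in>?S. (\<Sum>x\<in>?S. w powi x\<^sup>2 * w powi (- y\<^sup>2)))"
    unfolding gauss_sum_def cnj_sum cnj_powi sum_product by (rule sum.swap)
  also have "\<dots> = (\<Sum>y\<in>?S. (\<Sum>t\<in>?S. w powi t\<^sup>2 * w powi (2 * t * y)))"
  proof (rule sum.cong)
    fix y
    have "(\<Sum>x\<in>?S. w powi x\<^sup>2 * w powi (- y\<^sup>2))
        = (\<Sum>t\<in>?S. w powi ((t + y) mod int p)\<^sup>2 * w powi (- y\<^sup>2))"
      by (rule sum_mod_shift[OF p_pos, symmetric])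
    also have "\<dots> = (\<Sum>t\<in>?S. w powi t\<^sup>2 * w powi (2 * t * y))"
    proof (rule sum.cong)
      fix t
      have "w powi ((t + y) mod int p)\<^sup>2 = w powi (t + y)\<^sup>2"
        by (rule powi_cong) (simp add: cong_def power_mod)
      then have "w powi ((t + y) mod int p)\<^sup>2 * w powi (- y\<^sup>2) = w powi ((t + y)\<^sup>2 - y\<^sup>2)"
        using nonzero by (simp add: power_int_add[symmetric])
      also have "(t + y)\<^sup>2 - y\<^sup>2 = t\<^sup>2 + 2 * t * y" by (simp add: power2_eq_square algebra_simps)
      finally show "w powi ((t + y) mod int p)\<^sup>2 * w powi (- y\<^sup>2)
          = w powi t\<^sup>2 * w powi (2 * t * y)"
        using nonzero by (simp add: power_int_add)
    qed simp
    finally show "(\<Sum>x\<in>?S. w powi x\<^sup>2 * w powi (- y\<^sup>2))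
        = (\<Sum>t\<in>?S. w powi t\<^sup>2 * w powi (2 * t * y))" .
  qed simp
  also have "\<dots> = (\<Sum>t\<in>?S. w powi t\<^sup>2 * (\<Sum>y\<in>?S. w powi (2 * t * y)))"
    by (subst sum.swap) (simp add: sum_distrib_left)
  also have "\<dots> = (\<Sum>t\<in>?S. if t = 0 then of_nat p else 0)"
  proof (rule sum.cong)
    fix t assume t: "t \<in> ?S"
    have "\<not> p dvd 2" using assms p primes_dvd_imp_eq[OF p two_is_prime_nat] by auto
    then have "\<not> int p dvd 2" by (metis int_dvd_int_iff of_nat_numeral)
    then have "int p dvd 2 * t \<longleftrightarrow> int p dvd t"
      using p by (simp add: prime_dvd_mult_iff)
    also have "\<dots> \<longleftrightarrow> t = 0" using t zdvd_not_zless[of t "int p"] by fastforce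
    finally show "w powi t\<^sup>2 * (\<Sum>y\<in>?S. w powi (2 * t * y)) = (if t = 0 then of_nat p else 0)"
      by (simp add: sum_powi)
  qed simp
  also have "\<dots> = of_nat p" using p_pos by simp
  finally show ?thesis .
qed

text \<open>The term x = 0 contributes 1 to each Gauss sum, and the other terms run twice over all
  \<open>w powi x\<close> with x nonzero. So the two Gauss sums add up to twice the sum of all
  powers of w, which is 0.\<close>

lemma gauss_sum_nonresidue:
  assumes "2 < p" "\<not> QuadRes (int p) k"
  shows "gauss_sum p (w powi k) = - gauss_sum p w"
proof -
  have split: "(\<Sum>x\<in>{0..<int p}. f x) = f 0 + (\<Sum>x\<in>{1..<int p}. f x)" for f :: "int \<Rightarrow> complex"
  proof -
    have "{0..<int p} = insert 0 {1..<int p}" using p_pos by auto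
    then show ?thesis by simp
  qed
  have "gauss_sum p w + gauss_sum p (w powi k)
      = 2 + ((\<Sum>x\<in>{1..<int p}. w powi (x\<^sup>2)) + (\<Sum>x\<in>{1..<int p}. w powi (k * x\<^sup>2)))"
    unfolding gauss_sum_def by (simp add: split power_int_mult)
  also have "(\<Sum>x\<in>{1..<int p}. w powi (x\<^sup>2)) + (\<Sum>x\<in>{1..<int p}. w powi (k * x\<^sup>2))
      = 2 * (\<Sum>x\<in>{1..<int p}. w powi x)"
    using sum_squares_nonresidue[OF p assms, of "\<lambda>r. w powi r"] by (simp add: powi_mod)
  also have "2 + 2 * (\<Sum>x\<in>{1..<int p}. w powi x) = 2 * (\<Sum>x\<in>{0..<int p}. w powi x)"
    by (simp add: split)
  also have "(\<Sum>x\<in>{0..<int p}. w powi x) = 0"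
    using sum_powi[of 1] assms(1) by simp
  finally show ?thesis by (simp add: add_eq_0_iff)
qed

text \<open>The sign rule speaks only of nonresidue exponents, whereas -1 is a residue here. The
  passage from w to its inverse is therefore compared through w^(-k): both k and -k are nonresidues,
  and the two sign changes cancel.\<close>

lemma cnj_gauss_sum_1_mod_4:
  assumes "2 < p" "[p = 1] (mod 4)"
  shows "cnj (gauss_sum p w) = gauss_sum p w"
proof -
  obtain k where k: "\<not> QuadRes (int p) k" using exists_quadratic_nonresidue[OF p assms(1)] .
  obtain y where y: "[y\<^sup>2 = -1] (mod int p)"
    using QuadRes_minus_one[OF p assms(1)] assms(2) by (auto simp: QuadRes_def)
  have k': "\<not> QuadRes (int p) (- k)"
  proof
    assume "QuadRes (int p) (- k)"
    then obtain z where "[z\<^sup>2 = - k] (mod int p)" by (auto simp: QuadRes_def)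
    from cong_mult[OF y this] have "[(y * z)\<^sup>2 = k] (mod int p)" by (simp add: power_mult_distrib)
    then show False using k by (auto simp: QuadRes_def)
  qed
  have "\<not> int p dvd -1" using p assms(1) by simp
  then interpret inv: root_of_unity p "w powi (-1)" by (rule root_of_unity_powi)
  have "gauss_sum p (w powi (-1)) = - gauss_sum p ((w powi (-1)) powi k)"
    using inv.gauss_sum_nonresidue[OF assms(1) k] by simp
  also have "(w powi (-1)) powi k = w powi (- k)"
    by (simp only: power_int_mult[symmetric]) simp
  also have "- gauss_sum p (w powi (- k)) = gauss_sum p w"
    using gauss_sum_nonresidue[OF assms(1) k'] by simp
  finally show ?thesis by (simp only: cnj_gauss_sum)
qed

lemma cnj_gauss_sum_3_mod_4:
  assumes "2 < p" "[p = 3] (mod 4)"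
  shows "cnj (gauss_sum p w) = - gauss_sum p w"
proof -
  have "\<not> QuadRes (int p) (-1)"
    using QuadRes_minus_one[OF p assms(1)] assms(2) by (simp add: cong_def)
  then show ?thesis using gauss_sum_nonresidue[OF assms(1)] by (simp only: cnj_gauss_sum)
qed

lemma gauss_sum_1_mod_4:
  assumes "2 < p" "[p = 1] (mod 4)"
  obtains "gauss_sum p w = of_real (sqrt p)" | "gauss_sum p w = - of_real (sqrt p)"
proof -
  have "odd p" using p assms(1) prime_odd_nat by blast
  then have "(gauss_sum p w)\<^sup>2 = (of_real (sqrt p))\<^sup>2"
    using gauss_sum_mult_cnj cnj_gauss_sum_1_mod_4[OF assms]
    by (simp add: power2_eq_square flip: of_real_mult)
  then show ?thesis using that power2_eq_iff by blast
qed

lemma gauss_sum_3_mod_4: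
  assumes "2 < p" "[p = 3] (mod 4)"
  obtains "gauss_sum p w = \<i> * of_real (sqrt p)" | "gauss_sum p w = - (\<i> * of_real (sqrt p))"
proof -
  have "odd p" using p assms(1) prime_odd_nat by blast
  then have "- (gauss_sum p w)\<^sup>2 = of_nat p"
    using gauss_sum_mult_cnj cnj_gauss_sum_3_mod_4[OF assms] by (simp add: power2_eq_square)
  moreover have "(\<i> * of_real (sqrt p))\<^sup>2 = - of_nat p"
    by (simp add: power_mult_distrib power2_eq_square[of "of_real _"] flip: of_real_mult)
  ultimately have "(gauss_sum p w)\<^sup>2 = (\<i> * of_real (sqrt p))\<^sup>2"
    by (metis minus_minus)
  then show ?thesis using that power2_eq_iff by blast
qed

section \<open>The finite Fourier operator\<close>

text \<open>The concrete form of the operator in the theorem, with w in the role of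
  \<open>j 1 1\<close>. The value 0 off the range makes the two agree as functions on the whole
  ambient type, so one can be rewritten to the other.\<close>

definition dft :: "(int \<Rightarrow> complex) \<Rightarrow> (int \<Rightarrow> complex)" where
  "dft f = (\<lambda>x. if x \<in> {0..<int p}
     then 1 / of_real (sqrt p) * (\<Sum>y\<in>{0..<int p}. f y * w powi (x * y)) else 0)"

definition reflect :: "(int \<Rightarrow> complex) \<Rightarrow> (int \<Rightarrow> complex)" where
  "reflect f = (\<lambda>x. if x \<in> {0..<int p} then f ((- x) mod int p) else 0)"

lemma sqrt_p_square: "complex_of_real (sqrt p) * complex_of_real (sqrt p) = of_nat p"
  by (simp flip: of_real_mult)

text \<open>Fourier inversion: orthogonality in the intermediate variable y leaves only z = -x, and
  the resulting factor p cancels the square of the normalisation.\<close>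

lemma dft_dft: "dft (dft f) = reflect f"
proof
  fix x
  let ?S = "{0..<int p}" and ?c = "1 / complex_of_real (sqrt p)"
  show "dft (dft f) x = reflect f x"
  proof (cases "x \<in> ?S")
    case True
    have "dft (dft f) x = ?c * (\<Sum>y\<in>?S. (?c * (\<Sum>z\<in>?S. f z * w powi (y * z))) * w powi (x * y))"
      using True unfolding dft_def by simp
    also have "\<dots> = ?c * ?c * (\<Sum>y\<in>?S. \<Sum>z\<in>?S. f z * w powi ((z + x) * y))"
    proof -
      have "w powi ((z + x) * y) = w powi (y * z) * w powi (x * y)" for y z
        using nonzero by (simp add: algebra_simps power_int_add)
      then show ?thesis by (simp only: sum_distrib_left sum_distrib_right mult_ac)
    qed
    also have "(\<Sum>y\<in>?S. \<Sum>z\<in>?S. f z * w powi ((z + x) * y))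
        = (\<Sum>z\<in>?S. f z * (\<Sum>y\<in>?S. w powi ((z + x) * y)))"
      by (subst sum.swap) (simp add: sum_distrib_left)
    also have "\<dots> = (\<Sum>z\<in>?S. if z = (- x) mod int p then f z * of_nat p else 0)"
    proof (rule sum.cong)
      fix z assume z: "z \<in> ?S"
      have "int p dvd z + x \<longleftrightarrow> z mod int p = (- x) mod int p"
        by (simp add: mod_eq_dvd_iff)
      then show "f z * (\<Sum>y\<in>?S. w powi ((z + x) * y))
          = (if z = (- x) mod int p then f z * of_nat p else 0)"
        using z by (simp add: sum_powi)
    qed simp
    also have "\<dots> = f ((- x) mod int p) * of_nat p"
      using p_pos by simp
    also have "?c * ?c * (f ((- x) mod int p) * of_nat p) = f ((- x) mod int p)"
      using p_pos sqrt_p_square by (simp add: field_simps)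
    finally show ?thesis using True by (simp add: reflect_def)
  next
    case False
    then show ?thesis unfolding dft_def[of "dft f"] reflect_def by auto
  qed
qed

lemma reflect_reflect: "f \<in> fun_space {0..<int p} \<Longrightarrow> reflect (reflect f) = f"
  using p_pos by (auto simp: reflect_def fun_space_def fun_eq_iff mod_minus_eq)

lemma dft_reflect: "dft (reflect f) = reflect (dft f)"
  by (simp flip: dft_dft)

lemma dft_4: "f \<in> fun_space {0..<int p} \<Longrightarrow> (dft ^^ 4) f = f"
  by (simp add: numeral_eq_Suc dft_dft reflect_reflect)

lemma linear_dft: "linear_operator_on (fun_space {0..<int p}) dft"
  by (auto simp: linear_operator_on_def dft_def fun_space_def cscale_def fun_eq_iff
      sum_distrib_left sum.distrib algebra_simps)

text \<open>If \<open>\<alpha> ^ 4 = 1\<close>, this is the mean of the operators \<open>\<alpha> ^ (4 - k) A ^ k\<close> for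
  \<open>k < 4\<close>, where \<open>A\<close> is the transform and \<open>A\<^sup>2\<close> is the reflection.\<close>

definition eigenproj :: "complex \<Rightarrow> (int \<Rightarrow> complex) \<Rightarrow> (int \<Rightarrow> complex)" where
  "eigenproj \<alpha> f = (\<lambda>x. (f x + \<alpha> ^ 3 * dft f x + \<alpha> ^ 2 * reflect f x + \<alpha> * dft (reflect f) x) / 4)"

lemma eigenproj_eq:
  "eigenproj \<alpha> f = cscale (1/4) (f + cscale (\<alpha> ^ 3) (dft f) + cscale (\<alpha> ^ 2) (reflect f)
     + cscale \<alpha> (dft (reflect f)))"
  by (auto simp: eigenproj_def cscale_def fun_eq_iff)

lemma dft_add: "dft (f + g) = dft f + dft g"
  by (auto simp: dft_def fun_eq_iff sum.distrib algebra_simps)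

lemma dft_cscale: "dft (cscale c f) = cscale c (dft f)"
  by (auto simp: dft_def cscale_def fun_eq_iff sum_distrib_left algebra_simps)

lemma reflect_add: "reflect (f + g) = reflect f + reflect g"
  by (auto simp: reflect_def fun_eq_iff)

lemma reflect_cscale: "reflect (cscale c f) = cscale c (reflect f)"
  by (auto simp: reflect_def cscale_def fun_eq_iff)

lemma linear_eigenproj: "linear_operator_on (fun_space {0..<int p}) (eigenproj \<alpha>)"
  unfolding linear_operator_on_def
proof (intro conjI ballI allI Pi_I)
  show "eigenproj \<alpha> f \<in> fun_space {0..<int p}" if "f \<in> fun_space {0..<int p}" for f
    using that by (auto simp: eigenproj_def fun_space_def dft_def reflect_def)
  show "eigenproj \<alpha> (f + g) = eigenproj \<alpha> f + eigenproj \<alpha> g" for f g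
    unfolding eigenproj_def dft_add reflect_add by (auto simp: fun_eq_iff field_simps)
  show "eigenproj \<alpha> (cscale c f) = cscale c (eigenproj \<alpha> f)" for c f
    unfolding eigenproj_def dft_cscale reflect_cscale
    by (auto simp: fun_eq_iff cscale_def field_simps)
qed

text \<open>The four terms are the traces of the four summands of \<open>eigenproj\<close>, read on
  the diagonal: the identity gives p, the transform has diagonal entries w^(x^2) / sqrt p, the
  reflection fixes a single point, and the reflected transform gives the conjugate of the second
  trace.\<close>

lemma eigen_mult_dft:
  assumes "odd p" and \<alpha>: "\<alpha> ^ 4 = 1"
  shows "4 * of_nat (eigen_mult (fun_space {0..<int p}) dft \<alpha>) =
    of_nat p + \<alpha> ^ 3 * (gauss_sum p w / of_real (sqrt p)) + \<alpha> ^ 2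
      + \<alpha> * cnj (gauss_sum p w / of_real (sqrt p))"
proof -
  let ?S = "{0..<int p}" and ?c = "1 / complex_of_real (sqrt p)"
  let ?V = "fun_space ?S"
  let ?E = "{v \<in> ?V. dft v = cscale \<alpha> v}"
  have \<alpha>': "\<alpha> * (\<alpha> * (\<alpha> * \<alpha>)) = 1" using \<alpha> by (simp add: numeral_eq_Suc)
  have subE: "cvs.subspace ?E"
    unfolding cvs.subspace_def
  proof (intro conjI ballI allI)
    show "0 \<in> ?E" by (auto simp: fun_space_def dft_def cscale_def fun_eq_iff)
    show "u + v \<in> ?E" if "u \<in> ?E" "v \<in> ?E" for u v
      using that cvs.subspace_add[OF subspace_fun_space, of u ?S v]
      by (simp add: dft_add cvs.scale_right_distrib del: plus_fun_apply)
    show "cscale c v \<in> ?E" if "v \<in> ?E" for c v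
      using that cvs.subspace_scale[OF subspace_fun_space, of v ?S c]
      by (simp add: dft_cscale mult.commute)
  qed
  have into: "eigenproj \<alpha> v \<in> ?E" if v: "v \<in> ?V" for v
  proof -
    \<comment> \<open>The transform shifts the four summands cyclically;
      \<open>\<alpha> ^ 4 = 1\<close> and A^4 = id close the cycle.\<close>
    have "dft (eigenproj \<alpha> v) = cscale \<alpha> (eigenproj \<alpha> v)"
      unfolding eigenproj_eq dft_add dft_cscale
      using \<alpha>' v
      by (simp add: dft_dft dft_reflect reflect_reflect)
        (auto simp: fun_eq_iff cscale_def numeral_eq_Suc algebra_simps)
    moreover have "eigenproj \<alpha> v \<in> ?V"
      using linear_eigenproj[of \<alpha>] v by (auto simp: linear_operator_on_def Pi_iff)
    ultimately show ?thesis by simp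
  qed
  \<comment> \<open>On the eigenspace each of the last three summands becomes \<alpha>^4 times v, so
    the mean consists of four copies of v.\<close>
  have id: "eigenproj \<alpha> v = v" if v: "v \<in> ?E" for v
  proof -
    have 4: "\<alpha> * (\<alpha> * (\<alpha> * (\<alpha> * c))) = c" for c
      using \<alpha>' by (metis mult.assoc mult_1)
    have 1: "dft v = cscale \<alpha> v" using v by simp
    then have 2: "reflect v = cscale (\<alpha> * \<alpha>) v"
      by (simp add: dft_cscale flip: dft_dft)
    show ?thesis
      unfolding eigenproj_eq 2 dft_cscale 1
      by (auto simp: fun_eq_iff cscale_def power2_eq_square power3_eq_cube 4 mult.assoc)
  qed
  \<comment> \<open>Oddness of p leaves 0 as the only fixed point of the reflection; its trace is
    therefore 1.\<close>
  have *: "(- x) mod int p \<noteq> x" if "x \<in> ?S" "x \<noteq> 0" for x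
  proof
    assume "(- x) mod int p = x"
    then have "(- x) mod int p = x mod int p" using that by simp
    then have "int p dvd - x - x" by (simp only: mod_eq_dvd_iff)
    then have d: "int p dvd 2 * x" by (simp add: dvd_minus_iff[of _ "2 * x", symmetric] del: dvd_minus_iff)
    then have "int p dvd x" using assms(1) by (simp add: coprime_dvd_mult_right_iff)
    then show False using that zdvd_not_zless[of x "int p"] by simp
  qed
  have dft_delta: "dft (delta z) x = ?c * w powi (x * z)" if "x \<in> ?S" "z \<in> ?S" for x z
  proof -
    have "(\<Sum>y\<in>?S. delta z y * w powi (x * y)) = (\<Sum>y\<in>?S. if y = z then w powi (x * y) else 0)"
      by (rule sum.cong) (auto simp: delta_def)
    then show ?thesis using that by (simp add: dft_def)
  qed
  have "eigenproj \<alpha> (delta x) x = (1 + \<alpha> ^ 3 * (?c * w powi x\<^sup>2) + \<alpha> ^ 2 * (if x = 0 then 1 else 0)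
      + \<alpha> * (?c * w powi (- x\<^sup>2))) / 4" if x: "x \<in> ?S" for x
  proof -
    have "reflect (delta x) x = (if x = 0 then 1 else 0)"
      using x *[OF x] by (auto simp: reflect_def delta_def)
    moreover have "dft (reflect (delta x)) x = ?c * w powi (- x\<^sup>2)"
    proof -
      have "w powi ((- x) mod int p * x) = w powi (- x\<^sup>2)"
        by (rule powi_cong) (simp add: cong_def power2_eq_square mod_mult_left_eq)
      then show ?thesis
        unfolding dft_reflect
        using x dft_delta[of "(- x) mod int p" x] p_pos by (simp add: reflect_def)
    qed
    ultimately show ?thesis
      using dft_delta[OF x x] by (simp add: eigenproj_def delta_def power2_eq_square)
  qed
  then have "(\<Sum>x\<in>?S. eigenproj \<alpha> (delta x) x) =
    (\<Sum>x\<in>?S. (1 + \<alpha> ^ 3 * (?c * w powi x\<^sup>2) + \<alpha> ^ 2 * (if x = 0 then 1 else 0)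
      + \<alpha> * (?c * w powi (- x\<^sup>2))) / 4)" by (rule sum.cong[OF refl])
  also have "\<dots> = (of_nat p + \<alpha> ^ 3 * (?c * gauss_sum p w) + \<alpha> ^ 2 * (\<Sum>x\<in>?S. if x = 0 then 1 else 0)
      + \<alpha> * (?c * cnj (gauss_sum p w))) / 4"
    unfolding gauss_sum_def cnj_sum cnj_powi
    by (simp only: sum_divide_distrib[symmetric] sum.distrib sum_distrib_left[symmetric]) simp
  also have "(\<Sum>x\<in>?S. if x = 0 then 1 else 0) = (1 :: complex)" using p_pos by simp
  finally have "of_nat (cvs.dim ?E) = (of_nat p + \<alpha> ^ 3 * (?c * gauss_sum p w) + \<alpha> ^ 2 * 1
      + \<alpha> * (?c * cnj (gauss_sum p w))) / 4"
    using dim_eq_trace_projection[OF _ linear_eigenproj subE _ into id] by simp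
  then show ?thesis by (simp add: eigen_mult_def mult.commute)
qed

text \<open>Reduces a candidate spectrum to one complex identity for each fourth root of unity;
  injectivity of \<open>of_int\<close> brings the result back to integers.\<close>

lemma represents_spectrum_dft:
  assumes "odd p" and "\<And>\<alpha>. \<alpha> \<in> R4 \<Longrightarrow> 4 * of_int (zr4_coeff a \<alpha>) =
    of_nat p + \<alpha> ^ 3 * (gauss_sum p w / of_real (sqrt p)) + \<alpha> ^ 2
      + \<alpha> * cnj (gauss_sum p w / of_real (sqrt p))"
  shows "represents_spectrum a (fun_space {0..<int p}) dft"
  unfolding represents_spectrum_def
proof (intro conjI ballI)
  show "\<exists>B. finite B \<and> cvs.span B = fun_space {0..<int p}"
    using span_delta[of "{0..<int p}"] by (intro exI[of _ "delta ` {0..<int p}"]) simp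
  fix \<alpha> assume \<alpha>: "\<alpha> \<in> R4"
  then have "\<alpha> ^ 4 = 1" by (auto simp: R4_def)
  then have "(4 :: complex) * of_int (zr4_coeff a \<alpha>)
      = 4 * of_int (int (eigen_mult (fun_space {0..<int p}) dft \<alpha>))"
    using eigen_mult_dft[OF assms(1)] assms(2)[OF \<alpha>] by simp
  then show "zr4_coeff a \<alpha> = int (eigen_mult (fun_space {0..<int p}) dft \<alpha>)"
    by (simp only: mult_cancel_left of_int_eq_iff) simp
qed (simp_all add: subspace_fun_space linear_dft dft_4)

end

section \<open>Multiplicities in the two residue classes of p modulo 4\<close>

lemma zr4_coeff_of_nat_mult: "zr4_coeff (of_nat n * a) z = int n * zr4_coeff a z"
  by (induction n) (simp_all add: zero_zr4.rep_eq plus_zr4.rep_eq distrib_right)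

lemmas zr4_coeff_simps = zr4_coeff_of_nat_mult plus_zr4.rep_eq minus_zr4.rep_eq one_zr4.rep_eq
  root_elt.rep_eq s_elt_def

context root_of_unity
begin

text \<open>If the normalised Gauss sum is e = 1 or e = -1, four times the multiplicity is p + 1 + 2
  e at 1, p + 1 - 2 e at -1, and p - 1 at both imaginary roots. Only the eigenvalue e exceeds (p -
  1) / 4, by one.\<close>

lemma represents_spectrum_1_mod_4:
  assumes "2 < p" "[p = 1] (mod 4)"
  shows "gauss_sum p w = of_real (sqrt p) \<Longrightarrow>
      represents_spectrum (of_nat ((p - 1) div 4) * s_elt + 1) (fun_space {0..<int p}) dft" (is "?g1 \<Longrightarrow> ?r1")
    and "gauss_sum p w = - of_real (sqrt p) \<Longrightarrow>
      represents_spectrum (of_nat ((p - 1) div 4) * s_elt + \<lbrakk>-1\<rbrakk>\<^sub>R) (fun_space {0..<int p}) dft" (is "?g2 \<Longrightarrow> ?r2")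
proof -
  have odd: "odd p" using p assms(1) prime_odd_nat by blast
  have "p mod 4 = 1" using assms(2) by (simp add: cong_def)
  then have "p = 4 * ((p - 1) div 4) + 1" by presburger
  then obtain n where n: "p = 4 * n + 1" "(p - 1) div 4 = n" by blast
  have nz: "complex_of_real (sqrt p) \<noteq> 0" using p_pos by simp
  show ?r1 if ?g1
    by (rule represents_spectrum_dft[OF odd], unfold that n(2))
      (use nz in \<open>auto simp: R4_def zr4_coeff_simps n(1) complex_eq_iff power3_eq_cube power2_eq_square\<close>)
  show ?r2 if ?g2
    by (rule represents_spectrum_dft[OF odd], unfold that n(2))
      (use nz in \<open>auto simp: R4_def zr4_coeff_simps n(1) complex_eq_iff power3_eq_cube power2_eq_square\<close>)
qed

text \<open>If the normalised Gauss sum is g = i or g = -i, four times the multiplicity is p + 1 at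
  1, -1 and g, but p - 3 at the conjugate of g. Hence the value i goes with the removal of [-i], and
  conversely.\<close>

lemma represents_spectrum_3_mod_4:
  assumes "2 < p" "[p = 3] (mod 4)"
  shows "gauss_sum p w = \<i> * of_real (sqrt p) \<Longrightarrow>
      represents_spectrum (of_nat ((p + 1) div 4) * s_elt - \<lbrakk>-\<i>\<rbrakk>\<^sub>R) (fun_space {0..<int p}) dft" (is "?g1 \<Longrightarrow> ?r1")
    and "gauss_sum p w = - (\<i> * of_real (sqrt p)) \<Longrightarrow>
      represents_spectrum (of_nat ((p + 1) div 4) * s_elt - \<lbrakk>\<i>\<rbrakk>\<^sub>R) (fun_space {0..<int p}) dft" (is "?g2 \<Longrightarrow> ?r2")
proof -
  have odd: "odd p" using p assms(1) prime_odd_nat by blast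
  have "p mod 4 = 3" using assms(2) by (simp add: cong_def)
  then have "p + 1 = 4 * ((p + 1) div 4)" by presburger
  then obtain n where n: "p + 1 = 4 * n" "(p + 1) div 4 = n" by blast
  then have pn: "of_nat p = 4 * of_nat n - (1 :: complex)"
    by (metis add_diff_cancel_right' of_nat_1 of_nat_add of_nat_mult of_nat_numeral)
  have nz: "complex_of_real (sqrt p) \<noteq> 0" using p_pos by simp
  show ?r1 if ?g1
    by (rule represents_spectrum_dft[OF odd], unfold that n(2))
      (use nz in \<open>auto simp: R4_def zr4_coeff_simps pn complex_eq_iff power3_eq_cube power2_eq_square\<close>)
  show ?r2 if ?g2
    by (rule represents_spectrum_dft[OF odd], unfold that n(2))
      (use nz in \<open>auto simp: R4_def zr4_coeff_simps pn complex_eq_iff power3_eq_cube power2_eq_square\<close>)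
qed

end

section \<open>Isomorphisms from the cyclic group to its dual\<close>

lemma dual_group_integer_mod_group:
  assumes "0 < p"
  shows "\<chi> \<in> carrier (dual_group (integer_mod_group p)) \<longleftrightarrow>
    \<chi> \<in> extensional {0..<int p} \<and> (\<forall>x\<in>{0..<int p}. cmod (\<chi> x) = 1) \<and>
    (\<forall>x\<in>{0..<int p}. \<forall>y\<in>{0..<int p}. \<chi> ((x + y) mod int p) = \<chi> x * \<chi> y)"
  using assms
  by (auto simp: dual_group_def hom_def circle_group_def carrier_integer_mod_group Pi_iff)

lemma char_add:
  assumes "0 < p" "\<chi> \<in> carrier (dual_group (integer_mod_group p))"
    "x \<in> {0..<int p}" "y \<in> {0..<int p}"
  shows "\<chi> ((x + y) mod int p) = \<chi> x * \<chi> y"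
  using assms dual_group_integer_mod_group by blast

lemma char_value:
  assumes "1 < p" "\<chi> \<in> carrier (dual_group (integer_mod_group p))" "n < p"
  shows "\<chi> (int n) = \<chi> 1 ^ n"
  using assms(3)
proof (induction n)
  case 0
  have "\<chi> 0 = \<chi> 0 * \<chi> 0" using char_add[OF _ assms(2), of 0 0] assms(1) by simp
  \<comment> \<open>Unit modulus excludes the other solution 0 of the idempotent equation.\<close>
  moreover have "cmod (\<chi> 0) = 1"
    using assms(1,2) dual_group_integer_mod_group[of p \<chi>] by simp
  ultimately show ?case by auto
next
  case (Suc n)
  have "\<chi> ((1 + int n) mod int p) = \<chi> 1 * \<chi> (int n)"
    by (rule char_add) (use assms Suc.prems in auto)
  then show ?case using Suc by (simp add: add.commute)
qed

lemma char_one_root: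
  assumes "1 < p" "\<chi> \<in> carrier (dual_group (integer_mod_group p))"
  shows "\<chi> 1 ^ p = 1"
proof -
  \<comment> \<open>Adding 1 to p - 1 wraps around to 0, where the character is 1.\<close>
  have "\<chi> ((1 + int (p - 1)) mod int p) = \<chi> 1 * \<chi> (int (p - 1))"
    by (rule char_add) (use assms in auto)
  moreover have "1 + int (p - 1) = int p" using assms(1) by simp
  ultimately have "\<chi> (int 0) = \<chi> 1 * \<chi> (int (p - 1))" by (simp only: mod_self of_nat_0)
  then have "\<chi> 1 * \<chi> 1 ^ (p - 1) = 1"
    using char_value[OF assms, of 0] char_value[OF assms, of "p - 1"] assms(1) by simp
  then show ?thesis using assms(1) by (cases p) auto
qed

lemma char_eqI:
  assumes "1 < p" "\<chi> \<in> carrier (dual_group (integer_mod_group p))"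
    "\<psi> \<in> carrier (dual_group (integer_mod_group p))" "\<chi> 1 = \<psi> 1"
  shows "\<chi> = \<psi>"
proof (rule extensionalityI[of _ "{0..<int p}"])
  show "\<chi> \<in> extensional {0..<int p}" "\<psi> \<in> extensional {0..<int p}"
    using assms dual_group_integer_mod_group[of p] by auto
  fix x assume "x \<in> {0..<int p}"
  then have "x = int (nat x)" "nat x < p" by auto
  then show "\<chi> x = \<psi> x" using char_value[OF assms(1,2)] char_value[OF assms(1,3)] assms(4) by metis
qed

text \<open>Since 1 generates the group, multiplicativity in both arguments reduces j to the single
  number \<open>j 1 1\<close>.\<close>

lemma iso_dual_root:
  assumes p: "prime p" and j: "j \<in> iso (integer_mod_group p) (dual_group (integer_mod_group p))"
  defines "G \<equiv> integer_mod_group p"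
  shows "root_of_unity p (j 1 1)"
    and "pullback G j \<circ> fourier G = root_of_unity.dft p (j 1 1)"
proof -
  let ?S = "{0..<int p}"
  have p1: "1 < p" using p prime_gt_1_nat by blast
  have car: "carrier G = ?S" using p1 by (simp add: G_def carrier_integer_mod_group)
  have ord: "order G = p" by (simp add: order_def car)
  have jc: "j x \<in> carrier (dual_group G)" if "x \<in> ?S" for x
    using j that by (auto simp: iso_def hom_def car simp flip: G_def)
  have jm: "j ((x + y) mod int p) z = j x z * j y z" if "x \<in> ?S" "y \<in> ?S" "z \<in> ?S" for x y z
    using j that by (auto simp: iso_def hom_def car dual_group_def simp flip: G_def) (simp add: G_def)
  have inj: "inj_on j ?S" using j by (simp add: iso_def bij_betw_def car flip: G_def)
  have mem: "0 \<in> ?S" "1 \<in> ?S" using p1 by auto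
  have j0: "j 0 z = 1" if "z \<in> ?S" for z
  proof -
    have "j 0 z = j 0 z * j 0 z" using jm[OF mem(1) mem(1) that] by simp
    moreover have "cmod (j 0 z) = 1"
      using jc[OF mem(1)] that p1 dual_group_integer_mod_group[of p] by (simp add: G_def)
    ultimately show ?thesis by auto
  qed
  have j1: "j (int n) 1 = j 1 1 ^ n" if "n < p" for n
    using that
  proof (induction n)
    case 0
    then show ?case using j0[OF mem(2)] by simp
  next
    case (Suc n)
    then show ?case using jm[of 1 "int n" 1] mem by (simp add: add.commute)
  qed
  have jval: "j x y = j 1 1 powi (x * y)" if x: "x \<in> ?S" and y: "y \<in> ?S" for x y
  proof -
    obtain m n where mn: "x = int m" "y = int n" "m < p" "n < p"
      using x y by (metis atLeastLessThan_iff nonneg_int_cases of_nat_less_iff)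
    have "j x y = (j 1 1 ^ m) ^ n"
      using char_value[OF p1 jc[OF x, unfolded G_def] mn(4)] j1[OF mn(3)] mn(1,2) by simp
    also have "\<dots> = j 1 1 powi (int (m * n))" by (simp only: power_int_of_nat power_mult)
    finally show ?thesis using mn by simp
  qed
  \<comment> \<open>Otherwise the characters \<open>j 1\<close> and \<open>j 0\<close> agree at the
    generator, hence everywhere, against injectivity of j.\<close>
  have "j 1 1 \<noteq> 1"
  proof
    assume "j 1 1 = 1"
    then have "j 1 = j 0"
      using char_eqI[OF p1] jc mem j0 by (simp add: G_def)
    then show False using inj mem by (auto dest: inj_onD)
  qed
  then show root: "root_of_unity p (j 1 1)"
    using p char_one_root[OF p1] jc mem by (unfold_locales) (simp_all add: G_def)
  show "pullback G j \<circ> fourier G = root_of_unity.dft p (j 1 1)"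
    using jc jval
    by (auto simp: fun_eq_iff pullback_def fourier_def root_of_unity.dft_def[OF root] car ord
        intro!: sum.cong)
qed

context root_of_unity
begin

definition dual_iso :: "int \<Rightarrow> (int \<Rightarrow> complex)" where
  "dual_iso x = (\<lambda>y\<in>{0..<int p}. w powi (x * y))"

text \<open>Surjectivity is by counting: a character is determined by its value at \<open>1\<close>, which is one
  of at most \<open>p\<close> roots of unity.\<close>

lemma dual_iso: "dual_iso \<in> iso (integer_mod_group p) (dual_group (integer_mod_group p))"
proof -
  let ?S = "{0..<int p}" and ?D = "carrier (dual_group (integer_mod_group p))"
  have p1: "1 < p" using p prime_gt_1_nat by blast
  have memD: "dual_iso x \<in> ?D" for x
  proof -
    have "w powi (x * ((a + b) mod int p)) = w powi (x * a) * w powi (x * b)" for a b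
    proof -
      have "w powi (x * ((a + b) mod int p)) = w powi (x * a + x * b)"
        by (rule powi_cong) (simp add: cong_def mod_mult_right_eq distrib_left)
      then show ?thesis using nonzero by (simp add: power_int_add)
    qed
    then show ?thesis
      using p1 cmod_root by (auto simp: dual_group_integer_mod_group dual_iso_def norm_power_int)
  qed
  have inj: "inj_on dual_iso ?S"
  proof (rule inj_onI)
    fix x y assume xy: "x \<in> ?S" "y \<in> ?S" "dual_iso x = dual_iso y"
    have "w powi x = w powi y"
      using p1 fun_cong[OF xy(3), of 1] by (simp add: dual_iso_def)
    then have "w powi (x - y) = 1" using nonzero by (simp add: power_int_diff)
    then have "x mod int p = y mod int p" by (simp add: powi_eq_1_iff mod_eq_dvd_iff)
    then show "x = y" using xy by simp
  qed
  have injD: "inj_on (\<lambda>\<chi>. \<chi> 1) ?D"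
    using char_eqI[OF p1] by (auto intro!: inj_onI)
  have sub: "(\<lambda>\<chi>. \<chi> 1) ` ?D \<subseteq> {z. z ^ p = 1}"
    using char_one_root[OF p1] by auto
  have fin: "finite {z :: complex. z ^ p = 1}" using p1 finite_roots_unity[of p] by simp
  have finD: "finite ?D" using finite_subset[OF sub fin] injD finite_imageD by blast
  have "card ?D \<le> p"
    using card_inj_on_le[OF injD sub fin] card_roots_unity[of p, where 'a = complex] p1 by simp
  then have "dual_iso ` ?S = ?D"
    using memD card_image[OF inj] finD by (intro card_seteq) auto
  moreover have "dual_iso ((x + y) mod int p) = dual_iso x \<otimes>\<^bsub>dual_group (integer_mod_group p)\<^esub> dual_iso y"
    for x y
  proof -
    have "w powi ((x + y) mod int p * z) = w powi (x * z) * w powi (y * z)" for z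
    proof -
      have "w powi ((x + y) mod int p * z) = w powi (x * z + y * z)"
        by (rule powi_cong) (simp add: cong_def mod_mult_left_eq distrib_right)
      then show ?thesis using nonzero by (simp add: power_int_add)
    qed
    then show ?thesis
      using p1 by (auto simp: dual_iso_def dual_group_def carrier_integer_mod_group fun_eq_iff)
  qed
  ultimately show ?thesis
    using memD inj p1 by (auto simp: iso_def hom_def bij_betw_def carrier_integer_mod_group)
qed

lemma dual_iso_1_1: "dual_iso 1 1 = w"
  using prime_gt_1_nat[OF p] by (simp add: dual_iso_def)

end

section \<open>Realisation of both signs of the Gauss sum\<close>

lemma exists_root_of_unity:
  assumes "prime p"
  obtains w where "root_of_unity p w"
proof -
  have "card {z :: complex. z ^ p = 1} = p"
    using card_roots_unity_eq[of p] prime_gt_0_nat[OF assms] by simp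
  then have "\<not> {z :: complex. z ^ p = 1} \<subseteq> {1}"
    using card_mono[of "{1 :: complex}" "{z. z ^ p = 1}"] prime_gt_1_nat[OF assms] by auto
  then obtain w :: complex where "w ^ p = 1" "w \<noteq> 1" by blast
  then show ?thesis using that assms by (auto simp: root_of_unity_def)
qed

lemma exists_dual_iso_opposite:
  assumes "prime p" "2 < p"
  obtains j j' where
    "j \<in> iso (integer_mod_group p) (dual_group (integer_mod_group p))"
    "j' \<in> iso (integer_mod_group p) (dual_group (integer_mod_group p))"
    "gauss_sum p (j' 1 1) = - gauss_sum p (j 1 1)"
proof -
  obtain w where w: "root_of_unity p w" using exists_root_of_unity[OF assms(1)] .
  then interpret root_of_unity p w .
  obtain k where k: "\<not> QuadRes (int p) k" using exists_quadratic_nonresidue[OF assms] .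
  have "\<not> int p dvd k" using k by (rule nonresidue_not_dvd)
  then interpret k: root_of_unity p "w powi k" by (rule root_of_unity_powi)
  show ?thesis
    using that[OF dual_iso k.dual_iso] gauss_sum_nonresidue[OF assms(2) k]
    unfolding dual_iso_1_1 k.dual_iso_1_1 by blast
qed

theorem theorem4p3:
  fixes p :: nat and G :: "int monoid"
  assumes "prime p" and "p > 2" and "G = integer_mod_group p"
  shows
    "([p = 1] (mod 4) \<longrightarrow>
       (\<forall>j \<in> iso G (dual_group G).
          represents_spectrum (of_nat ((p - 1) div 4) * s_elt + 1)
            (fun_space (carrier G)) (pullback G j \<circ> fourier G) \<or>
          represents_spectrum (of_nat ((p - 1) div 4) * s_elt + \<lbrakk>-1\<rbrakk>\<^sub>R)
            (fun_space (carrier G)) (pullback G j \<circ> fourier G)) \<and>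
       (\<exists>j \<in> iso G (dual_group G).
          represents_spectrum (of_nat ((p - 1) div 4) * s_elt + 1)
            (fun_space (carrier G)) (pullback G j \<circ> fourier G)) \<and>
       (\<exists>j \<in> iso G (dual_group G).
          represents_spectrum (of_nat ((p - 1) div 4) * s_elt + \<lbrakk>-1\<rbrakk>\<^sub>R)
            (fun_space (carrier G)) (pullback G j \<circ> fourier G))) \<and>
     ([p = 3] (mod 4) \<longrightarrow>
       (\<forall>j \<in> iso G (dual_group G).
          represents_spectrum (of_nat ((p + 1) div 4) * s_elt - \<lbrakk>\<i>\<rbrakk>\<^sub>R)
            (fun_space (carrier G)) (pullback G j \<circ> fourier G) \<or>
          represents_spectrum (of_nat ((p + 1) div 4) * s_elt - \<lbrakk>-\<i>\<rbrakk>\<^sub>R)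
            (fun_space (carrier G)) (pullback G j \<circ> fourier G)) \<and>
       (\<exists>j \<in> iso G (dual_group G).
          represents_spectrum (of_nat ((p + 1) div 4) * s_elt - \<lbrakk>\<i>\<rbrakk>\<^sub>R)
            (fun_space (carrier G)) (pullback G j \<circ> fourier G)) \<and>
       (\<exists>j \<in> iso G (dual_group G).
          represents_spectrum (of_nat ((p + 1) div 4) * s_elt - \<lbrakk>-\<i>\<rbrakk>\<^sub>R)
            (fun_space (carrier G)) (pullback G j \<circ> fourier G)))"
proof -
  note p = assms(1,2)
  let ?V = "fun_space (carrier G)"
  let ?rep = "\<lambda>a j. represents_spectrum a ?V (pullback G j \<circ> fourier G)"
  have car: "carrier G = {0..<int p}" using p by (simp add: assms(3) carrier_integer_mod_group)
  have rep: "?rep a j \<longleftrightarrow> represents_spectrum a (fun_space {0..<int p}) (root_of_unity.dft p (j 1 1))"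
    and root: "root_of_unity p (j 1 1)" if "j \<in> iso G (dual_group G)" for a j
    using iso_dual_root[OF p(1), of j] that by (simp_all add: assms(3) car[unfolded assms(3)])
  \<comment> \<open>This one pair settles all existence claims: whichever of the two possible Gauss
    sums belongs to j, the other belongs to j'.\<close>
  obtain j j' where j: "j \<in> iso G (dual_group G)" and j': "j' \<in> iso G (dual_group G)"
    and opp: "gauss_sum p (j' 1 1) = - gauss_sum p (j 1 1)"
    using exists_dual_iso_opposite[OF p] unfolding assms(3) by metis
  show ?thesis
  proof (intro conjI impI)
    let ?r = "complex_of_real (sqrt p)"
    assume m: "[p = 1] (mod 4)"
    have r1: "?rep (of_nat ((p - 1) div 4) * s_elt + 1) j"
      if "j \<in> iso G (dual_group G)" "gauss_sum p (j 1 1) = ?r" for j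
      using root_of_unity.represents_spectrum_1_mod_4(1)[OF root p(2) m] rep that by blast
    have r2: "?rep (of_nat ((p - 1) div 4) * s_elt + \<lbrakk>-1\<rbrakk>\<^sub>R) j"
      if "j \<in> iso G (dual_group G)" "gauss_sum p (j 1 1) = - ?r" for j
      using root_of_unity.represents_spectrum_1_mod_4(2)[OF root p(2) m] rep that by blast
    have dich: "gauss_sum p (j 1 1) = ?r \<or> gauss_sum p (j 1 1) = - ?r"
      if "j \<in> iso G (dual_group G)" for j
      using root_of_unity.gauss_sum_1_mod_4[OF root[OF that] p(2) m] by blast
    show "\<forall>j\<in>iso G (dual_group G). ?rep (of_nat ((p - 1) div 4) * s_elt + 1) j \<or>
        ?rep (of_nat ((p - 1) div 4) * s_elt + \<lbrakk>-1\<rbrakk>\<^sub>R) j"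
      using r1 r2 dich by blast
    show "\<exists>j\<in>iso G (dual_group G). ?rep (of_nat ((p - 1) div 4) * s_elt + 1) j"
      using r1 dich[OF j] opp j j' by (metis minus_minus)
    show "\<exists>j\<in>iso G (dual_group G). ?rep (of_nat ((p - 1) div 4) * s_elt + \<lbrakk>-1\<rbrakk>\<^sub>R) j"
      using r2 dich[OF j] opp j j' by metis
  next
    let ?r = "\<i> * complex_of_real (sqrt p)"
    assume m: "[p = 3] (mod 4)"
    have r1: "?rep (of_nat ((p + 1) div 4) * s_elt - \<lbrakk>-\<i>\<rbrakk>\<^sub>R) j"
      if "j \<in> iso G (dual_group G)" "gauss_sum p (j 1 1) = ?r" for j
      using root_of_unity.represents_spectrum_3_mod_4(1)[OF root p(2) m] rep that by blast
    have r2: "?rep (of_nat ((p + 1) div 4) * s_elt - \<lbrakk>\<i>\<rbrakk>\<^sub>R) j"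
      if "j \<in> iso G (dual_group G)" "gauss_sum p (j 1 1) = - ?r" for j
      using root_of_unity.represents_spectrum_3_mod_4(2)[OF root p(2) m] rep that by blast
    have dich: "gauss_sum p (j 1 1) = ?r \<or> gauss_sum p (j 1 1) = - ?r"
      if "j \<in> iso G (dual_group G)" for j
      using root_of_unity.gauss_sum_3_mod_4[OF root[OF that] p(2) m] by blast
    show "\<forall>j\<in>iso G (dual_group G). ?rep (of_nat ((p + 1) div 4) * s_elt - \<lbrakk>\<i>\<rbrakk>\<^sub>R) j \<or>
        ?rep (of_nat ((p + 1) div 4) * s_elt - \<lbrakk>-\<i>\<rbrakk>\<^sub>R) j"
      using r1 r2 dich by blast
    show "\<exists>j\<in>iso G (dual_group G). ?rep (of_nat ((p + 1) div 4) * s_elt - \<lbrakk>\<i>\<rbrakk>\<^sub>R) j"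
      using r2 dich[OF j] opp j j' by metis
    show "\<exists>j\<in>iso G (dual_group G). ?rep (of_nat ((p + 1) div 4) * s_elt - \<lbrakk>-\<i>\<rbrakk>\<^sub>R) j"
      using r1 dich[OF j] opp j j' by (metis minus_minus)
  qed
qed

end
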